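(* Let $n\in\mathbb{N}$ and $K\subseteq[2,n+1]$. For $J\subseteq[2,n+1]$ denote $J^{\max}=J\cup\{n+2\}$, and let $\tau_n(i):=n+3-i$. Then $$\sum_{J\subseteq[2,n+1]\smallsetminus K}(-1)^{n-|K|+|J|}\alpha(J^{\max})\hat{!}=\sum_{J\subseteq K}(-1)^{|K|-|J|}(|J|+2)\,\alpha(\tau_{n}(J))\hat{!}.$$
   Context: Notation: $[a,b]=\{a,a+1,\dots,b\}$ (empty if $a>b$). For a finite set of positive integers $X=\{x_1<\dots<x_k\}$, $\alpha(X):=(x_1-1,\,x_2-x_1,\,x_3-x_2,\dots,x_k-x_{k-1})$. For a tuple $\beta=(\beta_1,\dots,\beta_k)$ of nonnegative integers, $\beta\hat{!}:=(k+1)^{\beta_1}k^{\beta_2}\cdots 3^{\beta_{k-1}}2^{\beta_k}$. By convention $\alpha(\emptyset)=()$ and $()\hat{!}=1$. For a set $W$, $\tau_n(W)=\{\tau_n(w)\mid w\in W\}$. *)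

theory Defs
  imports Main
begin

text \<open>
  The tuple \<open>(x\<^sub>1 - 1, x\<^sub>2 - x\<^sub>1, \<dots>, x\<^sub>k - x\<^bsub>k-1\<^esub>)\<close> of a finite set of positive integers
  \<open>x\<^sub>1 < \<dots> < x\<^sub>k\<close>. The second list in \<open>map2\<close> is one element too long; \<open>map2\<close> drops \<open>x\<^sub>k\<close>.
  Since the elements are positive and listed in increasing order, no subtraction truncates.
\<close>
definition alpha :: "nat set \<Rightarrow> nat list" where
  "alpha X = (let xs = sorted_list_of_set X in map2 (-) xs (1 # xs))"

text \<open>
  \<open>(k+1)^\<beta>\<^sub>1 \<cdot> k^\<beta>\<^sub>2 \<cdots> 2^\<beta>\<^sub>k\<close> with \<open>k = length \<beta>\<close>. Lists are indexed from \<open>0\<close>, so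
  \<open>\<beta> ! i\<close> is \<open>\<beta>\<^bsub>i+1\<^esub>\<close>.
\<close>
definition hat_fact :: "nat list \<Rightarrow> nat" where
  "hat_fact \<beta> = (\<Prod>i<length \<beta>. (length \<beta> + 1 - i) ^ (\<beta> ! i))"

text \<open>Only applied to \<open>i \<le> n + 1\<close>, where the subtraction does not truncate.\<close>
definition tau :: "nat \<Rightarrow> nat \<Rightarrow> nat" where
  "tau n i = n + 3 - i"

end

theory Submission
  imports Defs
begin

text \<open>
  Reading the exponents of \<open>hat_fact (alpha X)\<close> as run lengths gives one factor per integer:
  \<open>hat_fact (alpha X) = (\<Prod>p\<ge>1. 1 + card {x \<in> X. p < x})\<close> (\<open>hat_fact_alpha\<close>). Up to sign, the left-hand
  summand is thus the product of \<open>2 + card {x \<in> J. p < x}\<close> over \<open>p \<in> {1..n+1}\<close>, and, the reflection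
  \<open>tau n\<close> turning \<open>>\<close> into \<open>\<le>\<close>, the right-hand one is \<open>card J + 2\<close> times the product of
  \<open>1 + card {j \<in> J. j \<le> q}\<close> over \<open>q \<in> {1..n+1}\<close>.

  The identity is proved in a stronger form (\<open>complement_duality\<close>), in which an integer \<open>c \<ge> 0\<close> is
  added to every factor on the left. Call the left side \<open>L c\<close>. Enlarging the interval by a new
  largest point \<open>a\<close> acts on \<open>L\<close> by
  \<^item> \<open>L c \<mapsto> (c + 2) * L c\<close> if \<open>a\<close> is put into \<open>K\<close>, and
  \<^item> \<open>L c \<mapsto> (c + 2) * (L (c + 1) - L c)\<close> if it is not,
  since a point above all positions raises every old factor by one. On the right, the weights of the
  sets \<open>J\<close> of a given size \<open>k\<close> are acted upon too: the new factor is \<open>k + 1\<close> if \<open>J\<close> is kept, and if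
  \<open>a \<in> K\<close> then \<open>J\<close> may also grow to size \<open>k + 1\<close>, with new factor \<open>k + 2\<close>; in that case keeping \<open>J\<close>
  reverses its sign and enlarging it does not. The functions
  \<open>c \<mapsto> (c + k + 2) choose (c + 1)\<close> intertwine the two actions: on them the multiplication by
  \<open>c + 2\<close> and the difference operator have exactly these matrices (\<open>binomial_multiplication\<close> and
  \<open>binomial_difference\<close>). So \<open>L\<close> is the combination of these functions with the weights on the right
  as coefficients, and at \<open>c = 0\<close> the binomial coefficient is the factor \<open>k + 2\<close>.
\<close>

section \<open>One factor for each integer\<close>

lemma hat_fact_Nil: "hat_fact [] = 1"
  by (simp add: hat_fact_def)

lemma hat_fact_Cons: "hat_fact (b # bs) = (length bs + 2) ^ b * hat_fact bs"
  by (simp add: hat_fact_def prod.lessThan_Suc_shift del: prod.lessThan_Suc)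

text \<open>
  The integers from \<open>a\<close> up to, but excluding, the first entry see the whole list above them; the
  others do not see that entry, so they get the factors of the tail. The starting point \<open>a\<close> is arbitrary so that each tail can be treated in the same way.
\<close>
lemma hat_fact_differences:
  assumes "sorted_wrt (<) xs" and "set xs \<subseteq> {a..m}"
  shows "hat_fact (map2 (-) xs (a # xs)) = (\<Prod>p\<in>{a..<m}. 1 + card {x \<in> set xs. p < x})"
  using assms
proof (induction xs arbitrary: a)
  case Nil
  then show ?case by (simp add: hat_fact_Nil)
next
  case (Cons x ys)
  have ax: "a \<le> x" and xm: "x \<le> m" and above: "\<And>y. y \<in> set ys \<Longrightarrow> x < y"
    and sorted: "sorted_wrt (<) (x # ys)"
    using Cons.prems by auto
  have "distinct (x # ys)"
    using sorted strict_sorted_iff by blast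
  then have count: "card (set (x # ys)) = length ys + 1"
    using distinct_card by fastforce
  have low: "card {z \<in> set (x # ys). p < z} = length ys + 1" if "p \<in> {a..<x}" for p
  proof -
    have "{z \<in> set (x # ys). p < z} = set (x # ys)"
      using that above by fastforce
    then show ?thesis using count by simp
  qed
  have high: "{z \<in> set (x # ys). p < z} = {z \<in> set ys. p < z}" if "p \<in> {x..<m}" for p
    using that by auto
  have tail: "hat_fact (map2 (-) ys (x # ys)) = (\<Prod>p\<in>{x..<m}. 1 + card {z \<in> set ys. p < z})"
    using Cons.IH[of x] Cons.prems by fastforce
  have "(\<Prod>p\<in>{a..<m}. 1 + card {z \<in> set (x # ys). p < z})
      = (\<Prod>p\<in>{a..<x}. 1 + card {z \<in> set (x # ys). p < z})
        * (\<Prod>p\<in>{x..<m}. 1 + card {z \<in> set (x # ys). p < z})"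
    using ax xm by (simp only: prod.atLeastLessThan_concat)
  also have "\<dots> = (length ys + 2) ^ (x - a) * (\<Prod>p\<in>{x..<m}. 1 + card {z \<in> set ys. p < z})"
  proof (rule arg_cong2[of _ _ _ _ "(*)"])
    have "(\<Prod>p\<in>{a..<x}. 1 + card {z \<in> set (x # ys). p < z}) = (\<Prod>p\<in>{a..<x}. length ys + 2)"
      by (rule prod.cong[OF refl]) (use low in simp)
    then show "(\<Prod>p\<in>{a..<x}. 1 + card {z \<in> set (x # ys). p < z}) = (length ys + 2) ^ (x - a)"
      by simp
    show "(\<Prod>p\<in>{x..<m}. 1 + card {z \<in> set (x # ys). p < z})
        = (\<Prod>p\<in>{x..<m}. 1 + card {z \<in> set ys. p < z})"
      by (rule prod.cong[OF refl]) (use high in simp)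
  qed
  also have "\<dots> = hat_fact (map2 (-) (x # ys) (a # x # ys))"
    using tail by (simp add: hat_fact_Cons)
  finally show ?case by (rule sym)
qed

lemma hat_fact_alpha:
  assumes "X \<subseteq> {1..m}"
  shows "hat_fact (alpha X) = (\<Prod>p\<in>{1..<m}. 1 + card {x \<in> X. p < x})"
proof -
  have fin: "finite X"
    using assms finite_subset by blast
  define xs where "xs = sorted_list_of_set X"
  have xs: "set xs = X" "sorted_wrt (<) xs"
    using fin by (simp_all add: xs_def)
  show ?thesis
    using hat_fact_differences[of xs 1 m] xs assms by (simp add: alpha_def Let_def xs_def)
qed

section \<open>Alternating sums over subsets\<close>

definition alternating_sum :: "'a set \<Rightarrow> ('a set \<Rightarrow> int) \<Rightarrow> int" where
  "alternating_sum A f = (\<Sum>J\<in>Pow A. (-1) ^ (card A - card J) * f J)"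

lemma alternating_sum_empty: "alternating_sum {} f = f {}"
  by (simp add: alternating_sum_def)

lemma alternating_sum_cong:
  assumes "\<And>J. J \<subseteq> A \<Longrightarrow> f J = g J"
  shows "alternating_sum A f = alternating_sum A g"
  using assms by (auto simp: alternating_sum_def intro: sum.cong)

lemma alternating_sum_diff:
  "alternating_sum A (\<lambda>J. f J - g J) = alternating_sum A f - alternating_sum A g"
  by (simp add: alternating_sum_def right_diff_distrib sum_subtractf)

lemma alternating_sum_cmult:
  "alternating_sum A (\<lambda>J. c * f J) = c * alternating_sum A f"
  by (simp add: alternating_sum_def sum_distrib_left mult.left_commute)

lemma alternating_sum_insert:
  assumes "finite A" "a \<notin> A"
  shows "alternating_sum (insert a A) f = alternating_sum A (\<lambda>J. f (insert a J) - f J)"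
proof -
  let ?s = "\<lambda>J. (-1) ^ (card (insert a A) - card J) * f J"
  have disj: "Pow A \<inter> insert a ` Pow A = {}"
    using assms(2) by auto
  have inj: "inj_on (insert a) (Pow A)"
    using assms(2) by (auto simp: inj_on_def)
  have "alternating_sum (insert a A) f = sum ?s (Pow A) + sum ?s (insert a ` Pow A)"
    unfolding alternating_sum_def Pow_insert
    using assms(1) disj by (subst sum.union_disjoint) auto
  also have "sum ?s (insert a ` Pow A) = (\<Sum>J\<in>Pow A. ?s (insert a J))"
    using inj by (simp add: sum.reindex)
  also have "sum ?s (Pow A) + \<dots> = (\<Sum>J\<in>Pow A. ?s J + ?s (insert a J))"
    by (rule sum.distrib[symmetric])
  also have "\<dots> = alternating_sum A (\<lambda>J. f (insert a J) - f J)"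
    unfolding alternating_sum_def
  proof (rule sum.cong[OF refl])
    fix J assume "J \<in> Pow A"
    then have "finite J" "a \<notin> J" "card J \<le> card A"
      using assms finite_subset card_mono by auto
    then show "?s J + ?s (insert a J) = (-1) ^ (card A - card J) * (f (insert a J) - f J)"
      using assms by (simp add: Suc_diff_le algebra_simps)
  qed
  finally show ?thesis .
qed

section \<open>The duality between a set and its complement\<close>

lemma binomial_multiplication:
  "(k + 2) * ((c + k + 3) choose (c + 1))
   = (c + 2) * ((c + k + 2) choose (c + 1)) + (k + 1) * ((c + k + 2) choose (c + 1))"
proof -
  have "(k + 2) * ((c + k + 3) choose (c + 1)) = (c + k + 3) * ((c + k + 2) choose (c + 1))"
    using binomial_absorb_comp[of "c + k + 3" "c + 1"] by simp
  then show ?thesis by (simp add: algebra_simps)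
qed

lemma binomial_difference:
  "(c + 2) * ((c + k + 3) choose (c + 2))
   = (c + 2) * ((c + k + 2) choose (c + 1)) + (k + 1) * ((c + k + 2) choose (c + 1))"
  using Suc_times_binomial_eq[of "c + k + 2" "c + 1"] by (simp add: algebra_simps eval_nat_numeral)

text \<open>
  The parameter \<open>c\<close> makes the induction on \<open>n\<close> possible: when the new largest point lies outside
  \<open>K\<close>, the instance \<open>c + 1\<close> of the induction hypothesis is needed besides the instance \<open>c\<close>.
\<close>
lemma complement_duality:
  fixes n c :: nat and K :: "nat set"
  assumes "K \<subseteq> {2..n+1}"
  shows "alternating_sum ({2..n+1} - K) (\<lambda>J. \<Prod>p\<in>{1..n+1}. int (c + 2 + card {x \<in> J. p < x}))
       = alternating_sum K (\<lambda>J. int ((c + card J + 2) choose (c + 1)) *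
            (\<Prod>q\<in>{1..n+1}. int (1 + card {j \<in> J. j \<le> q})))"
  using assms
proof (induction n arbitrary: K c)
  case 0
  then have "K = {}" by simp
  then show ?case
    using binomial_symmetric[of "c + 1" "c + 2"] by (simp add: alternating_sum_empty)
next
  case (Suc n)
  let ?a = "n + 2"
  let ?P = "\<lambda>c J. \<Prod>p\<in>{1..n+1}. int (c + 2 + card {x \<in> J. p < x})"
  let ?Q = "\<lambda>J. \<Prod>q\<in>{1..n+1}. int (1 + card {j \<in> J. j \<le> q})"
  let ?b = "\<lambda>c J. int ((c + card J + 2) choose (c + 1))"
  have last: "{1..Suc n + 1} = insert ?a {1..n+1}" "?a \<notin> {1..n+1}"
    by auto
  have range: "{2..Suc n + 1} = insert ?a {2..n+1}"
    by auto
  have fin: "finite J" if "J \<subseteq> {2..n+1}" for J :: "nat set"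
    using that finite_subset by blast

  \<comment> \<open>The new position \<open>?a\<close> has nothing above it; the new point \<open>?a\<close> lies above all old positions.\<close>
  have P_old: "(\<Prod>p\<in>{1..Suc n + 1}. int (c + 2 + card {x \<in> J. p < x})) = int (c + 2) * ?P c J"
    if "J \<subseteq> {2..n+1}" for J c
  proof -
    have "card {x \<in> J. ?a < x} = 0" using that by (fastforce simp: card_eq_0_iff)
    then show ?thesis
      unfolding last(1) using last(2) by (subst prod.insert) simp_all
  qed
  have P_new: "(\<Prod>p\<in>{1..Suc n + 1}. int (c + 2 + card {x \<in> insert ?a J. p < x}))
      = int (c + 2) * ?P (c + 1) J" if J: "J \<subseteq> {2..n+1}" for J c
  proof -
    have "card {x \<in> insert ?a J. ?a < x} = 0" using J by (fastforce simp: card_eq_0_iff)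
    moreover have "card {x \<in> insert ?a J. p < x} = 1 + card {x \<in> J. p < x}"
      if "p \<in> {1..n+1}" for p
    proof -
      have "{x \<in> insert ?a J. p < x} = insert ?a {x \<in> J. p < x}" using that by auto
      moreover have "?a \<notin> {x \<in> J. p < x}" using J by auto
      ultimately show ?thesis using fin[OF J] by simp
    qed
    ultimately show ?thesis
      unfolding last(1) using last(2) by (subst prod.insert) (simp_all add: add_ac)
  qed

  \<comment> \<open>Here the new point \<open>?a\<close> is counted at the new position only.\<close>
  have Q_old: "(\<Prod>q\<in>{1..Suc n + 1}. int (1 + card {j \<in> J. j \<le> q})) = int (card J + 1) * ?Q J"
    if "J \<subseteq> {2..n+1}" for J
  proof -
    have "{j \<in> J. j \<le> ?a} = J" using that by auto
    then show ?thesis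
      unfolding last(1) using last(2) by (subst prod.insert) simp_all
  qed
  have Q_new: "(\<Prod>q\<in>{1..Suc n + 1}. int (1 + card {j \<in> insert ?a J. j \<le> q}))
      = int (card J + 2) * ?Q J" if J: "J \<subseteq> {2..n+1}" for J
  proof -
    have "{j \<in> insert ?a J. j \<le> ?a} = insert ?a J" "?a \<notin> J" using J by auto
    moreover have "{j \<in> insert ?a J. j \<le> q} = {j \<in> J. j \<le> q}" if "q \<in> {1..n+1}" for q
      using that by auto
    ultimately show ?thesis
      unfolding last(1) using last(2) fin[OF J] by (subst prod.insert) simp_all
  qed

  show ?case
  proof (cases "?a \<in> K")
    case True
    define K' where "K' = K - {?a}"
    have K: "K = insert ?a K'" and notin: "?a \<notin> K'"
      using True by (auto simp: K'_def)
    have K': "K' \<subseteq> {2..n+1}"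
      using Suc.prems range by (auto simp: K'_def)
    have compl: "{2..Suc n + 1} - K = {2..n+1} - K'"
      using range K by auto
    have "alternating_sum ({2..Suc n + 1} - K)
            (\<lambda>J. \<Prod>p\<in>{1..Suc n + 1}. int (c + 2 + card {x \<in> J. p < x}))
        = alternating_sum ({2..n+1} - K') (\<lambda>J. int (c + 2) * ?P c J)"
      unfolding compl by (rule alternating_sum_cong, rule P_old) auto
    also have "\<dots> = int (c + 2) * alternating_sum K' (\<lambda>J. ?b c J * ?Q J)"
      by (simp only: alternating_sum_cmult Suc.IH[OF K'])
    also have "\<dots> = alternating_sum K' (\<lambda>J. int (c + 2) * (?b c J * ?Q J))"
      by (simp only: alternating_sum_cmult)
    also have "\<dots> = alternating_sum K (\<lambda>J. ?b c J *
        (\<Prod>q\<in>{1..Suc n + 1}. int (1 + card {j \<in> J. j \<le> q})))"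
      unfolding K alternating_sum_insert[OF fin[OF K'] notin]
    proof (rule alternating_sum_cong)
      fix J assume "J \<subseteq> K'"
      then have J: "J \<subseteq> {2..n+1}" and "?a \<notin> J" using K' notin by auto
      then have card: "card (insert ?a J) = card J + 1"
        using fin[OF J] by simp
      have "int (c + 2) * ?b c J
          = int (card J + 2) * int ((c + card J + 3) choose (c + 1)) - int (card J + 1) * ?b c J"
        using arg_cong[OF binomial_multiplication[of "card J" c], of int]
        by (simp only: of_nat_add of_nat_mult)
      moreover have "?b c (insert ?a J) = int ((c + card J + 3) choose (c + 1))"
        unfolding card by (simp add: add_ac eval_nat_numeral)
      ultimately show "int (c + 2) * (?b c J * ?Q J)
          = ?b c (insert ?a J) * (\<Prod>q\<in>{1..Suc n + 1}. int (1 + card {j \<in> insert ?a J. j \<le> q}))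
            - ?b c J * (\<Prod>q\<in>{1..Suc n + 1}. int (1 + card {j \<in> J. j \<le> q}))"
        unfolding Q_old[OF J] Q_new[OF J] by algebra
    qed
    finally show ?thesis .
  next
    case False
    then have K: "K \<subseteq> {2..n+1}"
      using Suc.prems range by auto
    have compl: "{2..Suc n + 1} - K = insert ?a ({2..n+1} - K)"
      using range False by auto
    have "alternating_sum ({2..Suc n + 1} - K)
            (\<lambda>J. \<Prod>p\<in>{1..Suc n + 1}. int (c + 2 + card {x \<in> J. p < x}))
        = alternating_sum ({2..n+1} - K) (\<lambda>J. int (c + 2) * ?P (c + 1) J - int (c + 2) * ?P c J)"
      unfolding compl
      by (subst alternating_sum_insert, simp, simp, rule alternating_sum_cong)
         (subst P_new, blast, subst P_old, blast, rule refl)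
    also have "\<dots> = int (c + 2) * alternating_sum K (\<lambda>J. ?b (c + 1) J * ?Q J)
                   - int (c + 2) * alternating_sum K (\<lambda>J. ?b c J * ?Q J)"
      by (simp only: alternating_sum_diff alternating_sum_cmult Suc.IH[OF K])
    also have "\<dots> = alternating_sum K (\<lambda>J. int (c + 2) * (?b (c + 1) J * ?Q J)
                   - int (c + 2) * (?b c J * ?Q J))"
      by (simp only: alternating_sum_diff alternating_sum_cmult)
    also have "\<dots> = alternating_sum K (\<lambda>J. ?b c J *
        (\<Prod>q\<in>{1..Suc n + 1}. int (1 + card {j \<in> J. j \<le> q})))"
    proof (rule alternating_sum_cong)
      fix J assume "J \<subseteq> K"
      then have J: "J \<subseteq> {2..n+1}" using K by auto
      have "int (c + 2) * int ((c + card J + 3) choose (c + 2))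
          = int (c + 2) * ?b c J + int (card J + 1) * ?b c J"
        using arg_cong[OF binomial_difference[of c "card J"], of int]
        by (simp only: of_nat_add of_nat_mult)
      moreover have "?b (c + 1) J = int ((c + card J + 3) choose (c + 2))"
        by (simp add: add_ac eval_nat_numeral)
      ultimately show "int (c + 2) * (?b (c + 1) J * ?Q J) - int (c + 2) * (?b c J * ?Q J)
          = ?b c J * (\<Prod>q\<in>{1..Suc n + 1}. int (1 + card {j \<in> J. j \<le> q}))"
        unfolding Q_old[OF J] by algebra
    qed
    finally show ?thesis .
  qed
qed

section \<open>Translation of both sides\<close>

lemma hat_fact_alpha_insert_max:
  assumes "J \<subseteq> {2..n+1}"
  shows "hat_fact (alpha (J \<union> {n+2})) = (\<Prod>p\<in>{1..n+1}. 2 + card {x \<in> J. p < x})"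
proof -
  have "finite J" using assms finite_subset by blast
  have "1 + card {x \<in> J \<union> {n+2}. p < x} = 2 + card {x \<in> J. p < x}" if "p \<in> {1..n+1}" for p
  proof -
    have "{x \<in> J \<union> {n+2}. p < x} = insert (n+2) {x \<in> J. p < x}" using that by auto
    moreover have "n + 2 \<notin> {x \<in> J. p < x}" using assms by auto
    ultimately show ?thesis using \<open>finite J\<close> by simp
  qed
  moreover have "J \<union> {n+2} \<subseteq> {1..n+2}" using assms by auto
  moreover have "{1..<n+2} = {1..n+1}" by auto
  ultimately show ?thesis
    by (simp only: hat_fact_alpha) (rule prod.cong[OF refl])
qed

lemma hat_fact_alpha_tau:
  assumes "J \<subseteq> {2..n+1}"
  shows "hat_fact (alpha (tau n ` J)) = (\<Prod>q\<in>{1..n+1}. 1 + card {j \<in> J. j \<le> q})"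
proof -
  have "tau n ` J \<subseteq> {1..n+2}"
    using assms by (force simp: tau_def)
  then have "hat_fact (alpha (tau n ` J)) = (\<Prod>p\<in>{1..<n+2}. 1 + card {x \<in> tau n ` J. p < x})"
    by (rule hat_fact_alpha)
  also have "\<dots> = (\<Prod>q\<in>{1..n+1}. 1 + card {j \<in> J. j \<le> q})"
  proof (rule prod.reindex_bij_witness[of _ "\<lambda>q. n + 2 - q" "\<lambda>p. n + 2 - p"])
    fix p assume p: "p \<in> {1..<n+2}"
    have "{x \<in> tau n ` J. p < x} = tau n ` {j \<in> J. j \<le> n + 2 - p}"
      using assms p by (auto simp: tau_def image_iff)
    moreover have "inj_on (tau n) {j \<in> J. j \<le> n + 2 - p}"
      using assms by (fastforce simp: inj_on_def tau_def)
    ultimately show "1 + card {j \<in> J. j \<le> n + 2 - p} = 1 + card {x \<in> tau n ` J. p < x}"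
      by (simp add: card_image)
  qed auto
  finally show ?thesis .
qed

theorem corollary7p3:
  fixes n :: nat and K :: "nat set"
  assumes "K \<subseteq> {2..n+1}"
  shows "(\<Sum>J\<in>Pow ({2..n+1} - K).
            (-1) ^ (n - card K + card J) * int (hat_fact (alpha (J \<union> {n+2}))))
       = (\<Sum>J\<in>Pow K.
            (-1) ^ (card K - card J) * int (card J + 2) * int (hat_fact (alpha (tau n ` J))))"
proof -
  let ?A = "{2..n+1} - K"
  have fin: "finite K" using assms finite_subset by blast
  have card: "card ?A = n - card K"
    using assms fin by (simp add: card_Diff_subset)
  have sign: "(-1 :: int) ^ (n - card K + card J) = (-1) ^ (card ?A - card J)" if "J \<subseteq> ?A" for J
  proof -
    have "card J \<le> card ?A" using that by (simp add: card_mono)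
    then have "n - card K + card J = (card ?A - card J) + 2 * card J"
      unfolding card by simp
    then show ?thesis by (simp only: power_add power_mult) simp
  qed
  have "(\<Sum>J\<in>Pow ?A. (-1) ^ (n - card K + card J) * int (hat_fact (alpha (J \<union> {n+2}))))
      = alternating_sum ?A (\<lambda>J. \<Prod>p\<in>{1..n+1}. int (0 + 2 + card {x \<in> J. p < x}))"
    unfolding alternating_sum_def
  proof (rule sum.cong[OF refl])
    fix J assume "J \<in> Pow ?A"
    then have "J \<subseteq> ?A" "J \<subseteq> {2..n+1}" by auto
    then show "(-1) ^ (n - card K + card J) * int (hat_fact (alpha (J \<union> {n+2})))
        = (-1) ^ (card ?A - card J) * (\<Prod>p\<in>{1..n+1}. int (0 + 2 + card {x \<in> J. p < x}))"
      by (simp only: sign hat_fact_alpha_insert_max of_nat_prod add_0)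
  qed
  also have "\<dots> = alternating_sum K (\<lambda>J. int ((0 + card J + 2) choose (0 + 1)) *
      (\<Prod>q\<in>{1..n+1}. int (1 + card {j \<in> J. j \<le> q})))"
    by (rule complement_duality[OF assms])
  also have "\<dots> = (\<Sum>J\<in>Pow K.
      (-1) ^ (card K - card J) * int (card J + 2) * int (hat_fact (alpha (tau n ` J))))"
    unfolding alternating_sum_def
  proof (rule sum.cong[OF refl])
    fix J assume "J \<in> Pow K"
    then have "J \<subseteq> {2..n+1}" using assms by auto
    then show "(-1) ^ (card K - card J) * (int ((0 + card J + 2) choose (0 + 1)) *
          (\<Prod>q\<in>{1..n+1}. int (1 + card {j \<in> J. j \<le> q})))
        = (-1) ^ (card K - card J) * int (card J + 2) * int (hat_fact (alpha (tau n ` J)))"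
      by (simp only: hat_fact_alpha_tau of_nat_prod add_0 choose_one mult.assoc)
  qed
  finally show ?thesis .
qed

end
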